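(* Let $A$ and $B$ be real $d\times d$ matrices and define $f_{A,B}(Q)=\det(A+QBQ^T)$ for $Q\in O(d)$. Then for all $Q_0\in O(d)$, $$\mathbb{E}_{P\in A_d} f_{A,B}(P)=\mathbb{E}_{P\in A_d} f_{A,B}(PQ_0),$$ where $P$ is uniformly distributed on $A_d$.
   Context: $O(d)$ is the group of $d\times d$ real orthogonal matrices. $A_d$ denotes the group of orthogonal transformations of $\mathbb{R}^d$ that permute the vertices of a fixed regular simplex in $\mathbb{R}^d$ (with $d+1$ vertices, centered at the origin); it is a finite subgroup of $O(d)$. *)

theory Defs
  imports "HOL-Analysis.Analysis" "HOL-Probability.Probability_Mass_Function"
begin

text \<open>The dimension \<open>d\<close> is \<open>CARD('n)\<close>. The set \<open>V\<close> consists of the vertices of a nondegenerate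
  regular simplex in \<open>\<real>\<^sup>d\<close>: affinely independent points, all edges of the same length.\<close>

definition regular_simplex_vertices :: "(real^'n) set \<Rightarrow> bool" where
  "regular_simplex_vertices V \<longleftrightarrow>
     finite V \<and> card V = CARD('n) + 1 \<and> \<not> affine_dependent V \<and>
     (\<exists>l. \<forall>v\<in>V. \<forall>w\<in>V. v \<noteq> w \<longrightarrow> dist v w = l)"

text \<open>The barycentre is the mean of the vertices, so it is the origin iff the vertices sum to zero.\<close>

definition centered_regular_simplex :: "(real^'n) set \<Rightarrow> bool" where
  "centered_regular_simplex V \<longleftrightarrow> regular_simplex_vertices V \<and> (\<Sum>v\<in>V. v) = 0"

definition simplex_group :: "(real^'n) set \<Rightarrow> (real^'n^'n) set" where
  "simplex_group V = {Q. orthogonal_matrix Q \<and> (\<lambda>v. Q *v v) ` V = V}"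

definition f_det :: "real^'n^'n \<Rightarrow> real^'n^'n \<Rightarrow> real^'n^'n \<Rightarrow> real" where
  "f_det A B Q = det (A + Q ** B ** transpose Q)"

text \<open>\<open>pmf_of_set\<close> is the uniform distribution only on finite nonempty sets.\<close>

lemma simplex_group_nonempty: "simplex_group V \<noteq> {}"
proof -
  have "mat 1 \<in> simplex_group V"
    by (simp add: simplex_group_def orthogonal_matrix_id)
  then show ?thesis by blast
qed

lemma finite_simplex_group:
  fixes V :: "(real^'n) set"
  assumes "regular_simplex_vertices V"
  shows "finite (simplex_group V)"
proof -
  have fin: "finite V" and card: "card V = CARD('n) + 1" and ind: "\<not> affine_dependent V"
    using assms by (auto simp: regular_simplex_vertices_def)
  have "affine hull V = UNIV"
    using affine_independent_span_eq[OF ind] card by simp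
  then have span: "span V = UNIV"
    using affine_hull_subset_span[of V] by auto
  have "inj_on (\<lambda>Q. restrict ((*v) Q) V) (simplex_group V)"
  proof (rule inj_onI)
    fix P Q :: "real^'n^'n"
    assume eq: "restrict ((*v) P) V = restrict ((*v) Q) V"
    have "P *v x = Q *v x" if "x \<in> V" for x
      using fun_cong[OF eq, of x] that by simp
    then have "P *v x = Q *v x" for x
      using linear_eq_on_span[of "(*v) P" "(*v) Q" V x] span by auto
    then show "P = Q"
      by (simp add: matrix_eq)
  qed
  moreover have "(\<lambda>Q. restrict ((*v) Q) V) ` simplex_group V \<subseteq> (V \<rightarrow>\<^sub>E V)"
    by (auto simp: simplex_group_def)
  moreover have "finite (V \<rightarrow>\<^sub>E V)"
    using fin by (simp add: finite_PiE)
  ultimately show ?thesis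
    by (meson finite_imageD finite_subset)
qed

end

theory Submission
  imports Defs
begin

text \<open>Averaged over the simplex group, \<open>B \<mapsto> det (A + P B P\<^sup>T)\<close> becomes a function \<open>G\<close> that is affine
  along rank-one lines and invariant under conjugation by that group; the claim is that \<open>G\<close> is then
  invariant under conjugation by all of \<open>O(d)\<close>. The iterated differences of \<open>G\<close> at \<open>0\<close> in rank-one
  directions \<open>x\<^sub>i y\<^sub>i\<^sup>T\<close>, \<open>i \<le> k\<close>, determine \<open>G\<close>, are multilinear, and alternate in the \<open>x\<^sub>i\<close> and in the
  \<open>y\<^sub>i\<close>. Evaluated on vertices, invariance under transpositions of vertices and \<open>\<Sum>v = 0\<close> leave a single
  free constant for each \<open>k\<close> (the exterior powers of the standard representation of \<open>S\<^sub>d\<^sub>+\<^sub>1\<close> are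
  irreducible), so these differences are proportional to those of \<open>B \<mapsto> det (1 + B)\<close>, which is
  invariant under \<open>O(d)\<close>.\<close>

section \<open>Functions that are affine along rank-one lines\<close>

definition outer :: "real^'m \<Rightarrow> real^'n \<Rightarrow> real^'n^'m" where
  "outer x y = (\<chi> i j. x $ i * y $ j)"

lemma outer_add_left: "outer (x + x') y = outer x y + outer x' y"
  by (simp add: outer_def vec_eq_iff algebra_simps)

lemma outer_add_right: "outer x (y + y') = outer x y + outer x y'"
  by (simp add: outer_def vec_eq_iff algebra_simps)

lemma outer_diff_left: "outer (x - x') y = outer x y - outer x' y"
  by (simp add: outer_def vec_eq_iff algebra_simps)

lemma outer_diff_right: "outer x (y - y') = outer x y - outer x y'"
  by (simp add: outer_def vec_eq_iff algebra_simps)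

lemma outer_scaleR_left: "outer (c *\<^sub>R x) y = c *\<^sub>R outer x y"
  by (simp add: outer_def vec_eq_iff algebra_simps)

lemma outer_scaleR_right: "outer x (c *\<^sub>R y) = c *\<^sub>R outer x y"
  by (simp add: outer_def vec_eq_iff algebra_simps)

lemma matrix_mult_add_left: "(A + B) ** C = A ** C + B ** (C :: 'a::semiring_1^'p^'n)"
  by (simp add: matrix_matrix_mult_def vec_eq_iff sum.distrib distrib_right)

lemma matrix_mult_outer: "A ** outer x y = outer (A *v x) y"
  by (simp add: outer_def matrix_matrix_mult_def matrix_vector_mult_def vec_eq_iff
      sum_distrib_right mult.assoc)

lemma outer_mult_transpose: "outer x y ** transpose A = outer x (A *v y)"
  by (simp add: outer_def matrix_matrix_mult_def matrix_vector_mult_def vec_eq_iff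
      sum_distrib_left transpose_def mult_ac)

lemma outer_mult_vector: "outer x y *v z = (y \<bullet> z) *\<^sub>R x"
  by (simp add: outer_def matrix_vector_mult_def inner_vec_def vec_eq_iff sum_distrib_left mult_ac)

lemma matrix_eq_sum_outer: "(B :: real^'n^'m) = (\<Sum>i\<in>UNIV. outer (axis i 1) (row i B))"
  by (simp add: vec_eq_iff outer_def axis_def row_def if_distrib[of "\<lambda>z. z * _"] cong: if_cong)

text \<open>Affinity in \<open>t\<close> is expressed through the values at \<open>t = 0\<close> and
  \<open>t = 1\<close>, so no slope has to be named. The determinant is the model case.\<close>

definition rank_one_affine :: "(real^'n^'m \<Rightarrow> real) \<Rightarrow> bool" where
  "rank_one_affine g \<longleftrightarrow>
     (\<forall>B x y t. g (B + t *\<^sub>R outer x y) = g B + t * (g (B + outer x y) - g B))"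

lemma rank_one_affineD:
  "rank_one_affine g \<Longrightarrow> g (B + t *\<^sub>R outer x y) = g B + t * (g (B + outer x y) - g B)"
  unfolding rank_one_affine_def by blast

text \<open>\<open>B + (u + v)\<close> is the midpoint of \<open>B + 2u\<close> and
  \<open>B + 2v\<close>, and these two points lie on a rank-one line because \<open>u - v\<close>
  has rank one. This applies whenever \<open>u\<close> and \<open>v\<close> share a left or a right
  factor.\<close>

lemma rank_one_affine_add:
  assumes g: "rank_one_affine g" and u: "u = outer a b" and v: "v = outer c d"
    and uv: "u - v = outer e f"
  shows "g (B + (u + v)) - g B = (g (B + u) - g B) + (g (B + v) - g B)"
proof -
  have 1: "g (B + 2 *\<^sub>R u) = g B + 2 * (g (B + u) - g B)"
    unfolding u by (rule rank_one_affineD[OF g])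
  have 2: "g (B + 2 *\<^sub>R v) = g B + 2 * (g (B + v) - g B)"
    unfolding v by (rule rank_one_affineD[OF g])
  have o: "outer (2 *\<^sub>R e) f = 2 *\<^sub>R (u - v)"
    by (simp add: uv outer_scaleR_left)
  have e: "B + (u + v) = (B + 2 *\<^sub>R v) + (1/2) *\<^sub>R outer (2 *\<^sub>R e) f"
    "B + 2 *\<^sub>R u = (B + 2 *\<^sub>R v) + outer (2 *\<^sub>R e) f"
    by (simp_all add: o algebra_simps) (simp add: scaleR_2)
  have "g (B + (u + v)) = g (B + 2 *\<^sub>R v) + (1/2) * (g (B + 2 *\<^sub>R u) - g (B + 2 *\<^sub>R v))"
    unfolding e by (rule rank_one_affineD[OF g])
  with 1 2 show ?thesis by (simp add: algebra_simps)
qed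

lemma rank_one_affine_add_left:
  assumes "rank_one_affine g"
  shows "g (B + outer (x + x') y) - g B
    = (g (B + outer x y) - g B) + (g (B + outer x' y) - g B)"
  using rank_one_affine_add[OF assms refl refl outer_diff_left[symmetric]]
  by (simp add: outer_add_left)

lemma rank_one_affine_add_right:
  assumes "rank_one_affine g"
  shows "g (B + outer x (y + y')) - g B
    = (g (B + outer x y) - g B) + (g (B + outer x y') - g B)"
  using rank_one_affine_add[OF assms refl refl outer_diff_right[symmetric]]
  by (simp add: outer_add_right)

section \<open>Iterated differences in rank-one directions\<close>

fun rdiff :: "(real^'n^'m \<Rightarrow> real) \<Rightarrow> ((real^'m) \<times> (real^'n)) list \<Rightarrow> real^'n^'m \<Rightarrow> real" where
  "rdiff g [] B = g B"
| "rdiff g ((x, y) # ps) B = rdiff g ps (B + outer x y) - rdiff g ps B"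

text \<open>Translates and differences of such functions stay affine along rank-one lines. Hence
  each fact about one difference step applies to the function given by the tail of a list.\<close>

lemma rdiff_affine: "rank_one_affine g \<Longrightarrow> rank_one_affine (rdiff g ps)"
proof (induction ps)
  case Nil
  then show ?case by (simp add: rank_one_affine_def)
next
  case (Cons p ps)
  obtain a b where p: "p = (a, b)" by (cases p)
  have F: "rank_one_affine (rdiff g ps)" using Cons by blast
  show ?case
    unfolding rank_one_affine_def p
  proof (intro allI)
    fix B x y t
    have "rdiff g ps (B + outer a b + t *\<^sub>R outer x y) = rdiff g ps (B + outer a b)
       + t * (rdiff g ps (B + outer a b + outer x y) - rdiff g ps (B + outer a b))"
      by (rule rank_one_affineD[OF F])
    moreover have "rdiff g ps (B + t *\<^sub>R outer x y) = rdiff g ps B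
       + t * (rdiff g ps (B + outer x y) - rdiff g ps B)"
      by (rule rank_one_affineD[OF F])
    moreover have "B + t *\<^sub>R outer x y + outer a b = B + outer a b + t *\<^sub>R outer x y"
      "B + outer x y + outer a b = B + outer a b + outer x y"
      by (simp_all add: add_ac)
    ultimately show "rdiff g ((a, b) # ps) (B + t *\<^sub>R outer x y) = rdiff g ((a, b) # ps) B
       + t * (rdiff g ((a, b) # ps) (B + outer x y) - rdiff g ((a, b) # ps) B)"
      by (simp add: algebra_simps)
  qed
qed

text \<open>Difference operators commute. Any pair can therefore be moved to the head of the list,
  where the lemmas below act.\<close>

lemma rdiff_mset_eq:
  fixes ps qs :: "((real^'m) \<times> (real^'n)) list"
  assumes "mset ps = mset qs"
  shows "rdiff g ps B = rdiff g qs B"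
proof -
  define s where "s p F B = F (B + outer (fst p) (snd p)) - F B"
    for p :: "(real^'m) \<times> (real^'n)" and F :: "real^'n^'m \<Rightarrow> real" and B
  \<comment> \<open>The last pair of the list is the first to act on \<open>g\<close>, hence the
    reversal.\<close>
  have r: "rdiff g xs = List.fold s (rev xs) g" for xs :: "((real^'m) \<times> (real^'n)) list"
    by (induction xs) (auto simp: s_def fun_eq_iff)
  have "List.fold s (rev ps) = List.fold s (rev qs)"
    by (rule fold_multiset_equiv) (auto simp: s_def fun_eq_iff algebra_simps assms)
  then show ?thesis by (simp add: r)
qed

lemma rdiff_linear_left:
  assumes "rank_one_affine g"
  shows "linear (\<lambda>x. rdiff g ((x, y) # ps) B)"
proof (rule linearI)
  note F = rdiff_affine[OF assms, of ps]
  show "rdiff g ((x + x', y) # ps) B = rdiff g ((x, y) # ps) B + rdiff g ((x', y) # ps) B" for x x'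
    using rank_one_affine_add_left[OF F] by simp
  show "rdiff g ((c *\<^sub>R x, y) # ps) B = c *\<^sub>R rdiff g ((x, y) # ps) B" for c x
    using rank_one_affineD[OF F] by (simp add: outer_scaleR_left)
qed

lemma rdiff_linear_right:
  assumes "rank_one_affine g"
  shows "linear (\<lambda>y. rdiff g ((x, y) # ps) B)"
proof (rule linearI)
  note F = rdiff_affine[OF assms, of ps]
  show "rdiff g ((x, y + y') # ps) B = rdiff g ((x, y) # ps) B + rdiff g ((x, y') # ps) B" for y y'
    using rank_one_affine_add_right[OF F] by simp
  show "rdiff g ((x, c *\<^sub>R y) # ps) B = c *\<^sub>R rdiff g ((x, y) # ps) B" for c y
    using rank_one_affineD[OF F] by (simp add: outer_scaleR_right)
qed

text \<open>Two directions with the same left factor add up to a single outer product, so the second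
  difference is the defect of additivity in the right factor, which is zero.\<close>

lemma rdiff_same_fst:
  assumes "rank_one_affine g"
  shows "rdiff g ((x, y) # (x, y') # ps) B = 0"
  using rank_one_affine_add_right[OF rdiff_affine[OF assms, of ps], of B x y y']
  by (simp add: outer_add_right add.assoc)

lemma rdiff_same_snd:
  assumes "rank_one_affine g"
  shows "rdiff g ((x, y) # (x', y) # ps) B = 0"
  using rank_one_affine_add_left[OF rdiff_affine[OF assms, of ps], of B x x' y]
  by (simp add: outer_add_left add.assoc)

text \<open>Polarization: expand the vanishing difference with \<open>x + x'\<close> in both left
  slots.\<close>

lemma rdiff_swap:
  assumes g: "rank_one_affine g"
  shows "rdiff g ((x, y) # (x', y') # ps) B = - rdiff g ((x', y) # (x, y') # ps) B"
proof -
  have l: "rdiff g ((a, y) # (b + b', y') # ps) B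
      = rdiff g ((a, y) # (b, y') # ps) B + rdiff g ((a, y) # (b', y') # ps) B" for a b b'
  proof -
    have "rdiff g ((a, y) # (c, y') # ps) B = rdiff g ((c, y') # (a, y) # ps) B" for c
      by (rule rdiff_mset_eq) simp
    then show ?thesis using linear_add[OF rdiff_linear_left[OF g]] by metis
  qed
  have "0 = rdiff g ((x + x', y) # (x + x', y') # ps) B"
    by (simp add: rdiff_same_fst[OF g] del: rdiff.simps)
  also have "\<dots> = rdiff g ((x, y) # (x + x', y') # ps) B + rdiff g ((x', y) # (x + x', y') # ps) B"
    by (rule linear_add[OF rdiff_linear_left[OF g]])
  also have "\<dots> = rdiff g ((x, y) # (x', y') # ps) B + rdiff g ((x', y) # (x, y') # ps) B"
    unfolding l by (simp add: rdiff_same_fst[OF g] del: rdiff.simps)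
  finally show ?thesis by simp
qed

lemma rdiff_not_distinct_fst:
  assumes g: "rank_one_affine g" and "\<not> distinct (map fst ps)"
  shows "rdiff g ps B = 0"
proof -
  obtain xs x ys zs where "map fst ps = xs @ [x] @ ys @ [x] @ zs"
    using assms(2) not_distinct_decomp by blast
  then obtain as y bs y' cs where "ps = as @ [(x, y)] @ bs @ [(x, y')] @ cs"
    by (fastforce simp: map_eq_append_conv append_eq_map_conv Cons_eq_map_conv)
  then have "rdiff g ps B = rdiff g ((x, y) # (x, y') # as @ bs @ cs) B"
    by (intro rdiff_mset_eq) simp
  then show ?thesis by (simp add: rdiff_same_fst[OF g] del: rdiff.simps)
qed

lemma rdiff_not_distinct_snd:
  assumes g: "rank_one_affine g" and "\<not> distinct (map snd ps)"
  shows "rdiff g ps B = 0"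
proof -
  obtain xs x ys zs where "map snd ps = xs @ [x] @ ys @ [x] @ zs"
    using assms(2) not_distinct_decomp by blast
  then obtain as y bs y' cs where "ps = as @ [(y, x)] @ bs @ [(y', x)] @ cs"
    by (fastforce simp: map_eq_append_conv append_eq_map_conv Cons_eq_map_conv)
  then have "rdiff g ps B = rdiff g ((y, x) # (y', x) # as @ bs @ cs) B"
    by (intro rdiff_mset_eq) simp
  then show ?thesis by (simp add: rdiff_same_snd[OF g] del: rdiff.simps)
qed

lemma rdiff_conj:
  fixes Q :: "real^'n^'n"
  shows "rdiff (\<lambda>B. g (Q ** B ** transpose Q)) ps B
    = rdiff g (map (map_prod ((*v) Q) ((*v) Q)) ps) (Q ** B ** transpose Q)"
  by (induction ps arbitrary: B)
    (auto simp: matrix_add_ldistrib matrix_mult_add_left matrix_mult_outer outer_mult_transpose)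

lemma rdiff_diff_scale:
  "rdiff (\<lambda>B. g B - c * h B) ps B = rdiff g ps B - c * rdiff h ps B"
  by (induction ps arbitrary: B) (auto simp: algebra_simps)

lemma rank_one_affine_diff_scale:
  assumes "rank_one_affine g" "rank_one_affine h"
  shows "rank_one_affine (\<lambda>B. g B - c * h B)"
  unfolding rank_one_affine_def
  by (auto simp: rank_one_affineD[OF assms(1)] rank_one_affineD[OF assms(2)] algebra_simps)

lemma rank_one_affine_sum:
  assumes "\<And>i. i \<in> I \<Longrightarrow> rank_one_affine (g i)"
  shows "rank_one_affine (\<lambda>B. \<Sum>i\<in>I. g i B)"
  unfolding rank_one_affine_def
  by (simp add: rank_one_affineD[OF assms] sum.distrib sum_subtractf flip: sum_distrib_left)

lemma rank_one_affine_conj: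
  fixes Q :: "real^'n^'n"
  assumes "rank_one_affine g"
  shows "rank_one_affine (\<lambda>B. g (A + Q ** B ** transpose Q))"
  unfolding rank_one_affine_def
proof (intro allI)
  fix B x y t
  have e: "Q ** (t *\<^sub>R outer x y) ** transpose Q = t *\<^sub>R outer (Q *v x) (Q *v y)" for t x y
    by (simp add: matrix_mult_outer outer_mult_transpose matrix_vector_mult_scaleR
        flip: outer_scaleR_left)
  show "g (A + Q ** (B + t *\<^sub>R outer x y) ** transpose Q) = g (A + Q ** B ** transpose Q)
    + t * (g (A + Q ** (B + outer x y) ** transpose Q) - g (A + Q ** B ** transpose Q))"
    using rank_one_affineD[OF assms, of "A + Q ** B ** transpose Q" t "Q *v x" "Q *v y"]
      e[of t x y] e[of 1 x y]
    by (simp add: matrix_add_ldistrib matrix_mult_add_left add.assoc)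
qed

text \<open>A matrix is the sum of its rows as rank-one matrices. Adding one row changes a
  difference by a difference that is one pair longer, so vanishing of all of them spreads from
  \<open>0\<close> row by row.\<close>

lemma eq_0_if_rdiff_0:
  fixes B :: "real^'n^'m"
  assumes "\<And>ps. rdiff g ps 0 = 0"
  shows "g B = 0"
proof -
  have "rdiff g ps (\<Sum>i\<in>I. outer (axis i 1) (row i B)) = 0" if "finite I" for I :: "'m set" and ps
    using that
  proof (induction I arbitrary: ps)
    case empty
    then show ?case using assms by simp
  next
    case (insert i I)
    let ?S = "\<Sum>i\<in>I. outer (axis i 1) (row i B)"
    have "rdiff g ((axis i 1, row i B) # ps) ?S = 0" "rdiff g ps ?S = 0"
      using insert.IH by blast+
    then show ?case using insert.hyps by (simp add: add.commute)
  qed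
  from this[OF finite, of "[]" UNIV] show ?thesis
    by (simp flip: matrix_eq_sum_outer)
qed

text \<open>An orthogonal change of basis turns \<open>x\<close> into a multiple of a basis vector;
  the perturbation then affects a single row, in which the determinant is linear.\<close>

lemma det_rank_one_affine: "rank_one_affine (det :: real^'n^'n \<Rightarrow> real)"
  unfolding rank_one_affine_def
proof (intro allI)
  fix B :: "real^'n^'n" and x y :: "real^'n" and t :: real
  \<comment> \<open>Any index serves as the row to be perturbed.\<close>
  obtain k :: 'n where True by simp
  obtain f where f: "orthogonal_transformation f" "f (norm x *\<^sub>R axis k (1 :: real)) = x"
    using rotation_rightward_line by metis
  define R where "R = matrix f"
  define e :: "real^'n" where "e = norm x *\<^sub>R axis k 1"
  have R: "orthogonal_matrix R" and Rx: "R *v e = x"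
    using f orthogonal_transformation_matrix[of f]
    by (auto simp: R_def e_def matrix_works orthogonal_transformation_linear)
  let ?C = "transpose R ** B"
  let ?D = "(\<chi> i. if i = k then norm x *\<^sub>R y else ?C $ i) :: real^'n^'n"
  have "det (B + s *\<^sub>R outer x y) = det R * (det ?C + s * det ?D)" for s
  proof -
    have 0: "(\<chi> i. if i = k then ?C $ i else ?C $ i) = ?C"
      by (simp add: vec_eq_iff)
    have "R ** (s *\<^sub>R outer e y) = s *\<^sub>R outer x y"
      by (simp add: matrix_mult_outer matrix_vector_mult_scaleR Rx flip: outer_scaleR_left)
    then have "B + s *\<^sub>R outer x y = R ** (?C + s *\<^sub>R outer e y)"
      using R by (simp add: matrix_add_ldistrib matrix_mul_assoc orthogonal_matrix_def)
    moreover have "?C + s *\<^sub>R outer e y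
       = (\<chi> i. if i = k then ?C $ i + s *s (norm x *\<^sub>R y) else ?C $ i)"
      by (simp add: vec_eq_iff outer_def axis_def e_def)
    ultimately show ?thesis
      using det_row_add[of k "\<lambda>i. ?C $ i" "\<lambda>i. s *s (norm x *\<^sub>R y)" "\<lambda>i. ?C $ i"]
        det_row_mul[of k s "\<lambda>i. norm x *\<^sub>R y" "\<lambda>i. ?C $ i"]
      by (simp add: det_mul 0)
  qed
  from this[of t] this[of 0] this[of 1]
  show "det (B + t *\<^sub>R outer x y) = det B + t * (det (B + outer x y) - det B)"
    by (simp add: algebra_simps)
qed

lemma f_det_rank_one_affine: "rank_one_affine (\<lambda>B. f_det A B Q)"
  unfolding f_det_def by (rule rank_one_affine_conj[OF det_rank_one_affine])

section \<open>Symmetries of a centered regular simplex\<close>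

text \<open>The Householder reflection in the hyperplane orthogonal to \<open>u - v\<close>; for
  \<open>u = v\<close> it is the identity.\<close>

definition swap_refl :: "real^'n \<Rightarrow> real^'n \<Rightarrow> real^'n^'n" where
  "swap_refl u v = mat 1 - (2 / ((u - v) \<bullet> (u - v))) *\<^sub>R outer (u - v) (u - v)"

lemma swap_refl_mult_vector:
  "swap_refl u v *v z = z - (2 * ((u - v) \<bullet> z) / ((u - v) \<bullet> (u - v))) *\<^sub>R (u - v)"
  by (simp add: swap_refl_def matrix_vector_mult_diff_rdistrib outer_mult_vector
      flip: scaleR_matrix_vector_assoc)

lemma orthogonal_matrix_swap_refl: "orthogonal_matrix (swap_refl u v)"
proof -
  have "(swap_refl u v *v y) \<bullet> (swap_refl u v *v z) = y \<bullet> z" for y z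
  proof (cases "u = v")
    case False
    define w where "w = u - v"
    define a b where "a = 2 * (w \<bullet> y) / (w \<bullet> w)" and "b = 2 * (w \<bullet> z) / (w \<bullet> w)"
    have "a * (w \<bullet> w) = 2 * (w \<bullet> y)" "b * (w \<bullet> w) = 2 * (w \<bullet> z)"
      using False by (simp_all add: a_def b_def w_def)
    then have e: "w \<bullet> y = a * (w \<bullet> w) / 2" "w \<bullet> z = b * (w \<bullet> w) / 2" by simp_all
    have "(y - a *\<^sub>R w) \<bullet> (z - b *\<^sub>R w)
        = y \<bullet> z - b * (w \<bullet> y) - a * (w \<bullet> z) + a * b * (w \<bullet> w)"
      by (simp add: inner_diff_left inner_diff_right inner_commute[of y w] algebra_simps)
    also have "\<dots> = y \<bullet> z" unfolding e by simp
    finally have "(y - a *\<^sub>R w) \<bullet> (z - b *\<^sub>R w) = y \<bullet> z" .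
    then show ?thesis
      by (simp add: swap_refl_mult_vector a_def b_def flip: w_def)
  qed (simp add: swap_refl_mult_vector)
  then have "orthogonal_transformation ((*v) (swap_refl u v))"
    by (simp add: orthogonal_transformation_def)
  then show ?thesis
    by (simp add: orthogonal_transformation_matrix matrix_of_matrix_vector_mul)
qed

lemma simplex_group_mult:
  assumes "P \<in> simplex_group V" "Q \<in> simplex_group V"
  shows "P ** Q \<in> simplex_group V"
proof -
  have "(*v) (P ** Q) ` V = (*v) P ` ((*v) Q ` V)"
    by (simp add: image_image matrix_vector_mul_assoc)
  then show ?thesis
    using assms by (simp add: simplex_group_def orthogonal_matrix_mul)
qed

text \<open>Reindexing by this bijection makes the sum over the group invariant under conjugation of
  \<open>B\<close> by group elements.\<close>

lemma simplex_group_right_translate: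
  assumes "regular_simplex_vertices V" "R \<in> simplex_group V"
  shows "bij_betw (\<lambda>P. P ** R) (simplex_group V) (simplex_group V)"
proof -
  have "R ** transpose R = mat 1"
    using assms(2) by (simp add: simplex_group_def orthogonal_matrix_def)
  then have "inj_on (\<lambda>P. P ** R) (simplex_group V)"
    by (intro inj_on_inverseI[where g = "\<lambda>X. X ** transpose R"]) (simp flip: matrix_mul_assoc)
  moreover have "(\<lambda>P. P ** R) ` simplex_group V \<subseteq> simplex_group V"
    using assms(2) simplex_group_mult by blast
  ultimately show ?thesis
    using finite_simplex_group[OF assms(1)] by (simp add: bij_betw_def endo_inj_surj)
qed

section \<open>Geometry of the simplex and permutations of its vertices\<close>

locale centered_simplex =
  fixes V :: "(real^'n) set"
  assumes centered: "centered_regular_simplex V"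
begin

lemma finite_V: "finite V" and card_V: "card V = CARD('n) + 1" and sum_V: "(\<Sum>v\<in>V. v) = 0"
  using centered by (auto simp: centered_regular_simplex_def regular_simplex_vertices_def)

lemma span_V: "span V = UNIV"
proof -
  have "\<not> affine_dependent V"
    using centered by (simp add: centered_regular_simplex_def regular_simplex_vertices_def)
  then have "affine hull V = UNIV"
    using affine_independent_span_eq card_V by force
  then show ?thesis
    using affine_hull_subset_span[of V] by auto
qed

lemma edge_length:
  "\<exists>l. \<forall>v\<in>V. \<forall>w\<in>V. v \<noteq> w \<longrightarrow> (v - w) \<bullet> (v - w) = l"
proof -
  obtain l where "\<forall>v\<in>V. \<forall>w\<in>V. v \<noteq> w \<longrightarrow> dist v w = l"
    using centered by (auto simp: centered_regular_simplex_def regular_simplex_vertices_def)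
  then have "\<forall>v\<in>V. \<forall>w\<in>V. v \<noteq> w \<longrightarrow> (v - w) \<bullet> (v - w) = l\<^sup>2"
    by (metis dist_norm power2_norm_eq_inner)
  then show ?thesis ..
qed

text \<open>Sum the squared distances from \<open>u\<close> to all vertices. The cross terms vanish
  because the vertices sum to zero, so the squared edge length and the total of the squared norms
  determine \<open>u \<bullet> u\<close>.\<close>

lemma inner_self_vertex:
  assumes "u \<in> V" "v \<in> V"
  shows "u \<bullet> u = v \<bullet> v"
proof -
  obtain l where l: "\<forall>v\<in>V. \<forall>w\<in>V. v \<noteq> w \<longrightarrow> (v - w) \<bullet> (v - w) = l"
    using edge_length ..
  have "real (card V) * (u \<bullet> u) + (\<Sum>w\<in>V. w \<bullet> w) = (real (card V) - 1) * l" if u: "u \<in> V" for u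
  proof -
    have "(\<Sum>w\<in>V. (u - w) \<bullet> (u - w)) = (\<Sum>w\<in>V. u \<bullet> u + w \<bullet> w - 2 * (u \<bullet> w))"
      by (rule sum.cong) (auto simp: inner_diff_left inner_diff_right inner_commute)
    also have "\<dots> = real (card V) * (u \<bullet> u) + (\<Sum>w\<in>V. w \<bullet> w) - 2 * (u \<bullet> (\<Sum>w\<in>V. w))"
      by (simp add: sum.distrib sum_subtractf inner_sum_right sum_distrib_left)
    finally have "(\<Sum>w\<in>V. (u - w) \<bullet> (u - w)) = real (card V) * (u \<bullet> u) + (\<Sum>w\<in>V. w \<bullet> w)"
      by (simp add: sum_V)
    moreover have "(\<Sum>w\<in>V. (u - w) \<bullet> (u - w)) = (\<Sum>w\<in>V - {u}. (u - w) \<bullet> (u - w))"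
      using u finite_V by (simp add: sum.remove[of V u])
    moreover have "\<dots> = (\<Sum>w\<in>V - {u}. l)"
      using l u by (intro sum.cong) auto
    ultimately show ?thesis
      using u finite_V card_V by simp
  qed
  from this[OF assms(1)] this[OF assms(2)]
  have "real (card V) * (u \<bullet> u) = real (card V) * (v \<bullet> v)" by linarith
  then show ?thesis using card_V by simp
qed

text \<open>Since \<open>u\<close> and \<open>v\<close> have equal norm, the reflection exchanges
  them; every other vertex is equidistant from both, hence orthogonal to \<open>u - v\<close> and
  fixed. Thus each transposition of vertices is a symmetry.\<close>

lemma swap_refl_vertex:
  assumes "u \<in> V" "v \<in> V" "w \<in> V" "u \<noteq> v"
  shows "swap_refl u v *v w = (if w = u then v else if w = v then u else w)"
proof -
  have n: "(u - v) \<bullet> (u - v) = 2 * ((u - v) \<bullet> u)" "(u - v) \<bullet> (u - v) = - 2 * ((u - v) \<bullet> v)"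
    using inner_self_vertex[OF assms(1,2)]
    by (simp_all add: inner_diff_left inner_diff_right inner_commute)
  have nz: "(u - v) \<bullet> (u - v) \<noteq> 0" using assms by simp
  consider "w = u" | "w = v" | "w \<noteq> u" "w \<noteq> v" by blast
  then show ?thesis
  proof cases
    case 1
    have c: "2 * ((u - v) \<bullet> w) / ((u - v) \<bullet> (u - v)) = 1"
      using n(1) nz 1 by (metis divide_self)
    show ?thesis unfolding swap_refl_mult_vector c using 1 by simp
  next
    case 2
    have c: "2 * ((u - v) \<bullet> w) / ((u - v) \<bullet> (u - v)) = -1"
      using n(2) nz 2 by (simp add: field_simps)
    show ?thesis unfolding swap_refl_mult_vector c using 2 assms by simp
  next
    case 3
    have "(w - u) \<bullet> (w - u) = (w - v) \<bullet> (w - v)"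
      using edge_length 3 assms by auto
    then have "(u - v) \<bullet> w = 0"
      using inner_self_vertex[OF assms(1,2)]
      by (simp add: inner_diff_left inner_diff_right inner_commute)
    then show ?thesis using 3 by (simp add: swap_refl_mult_vector)
  qed
qed

lemma swap_refl_in_simplex_group:
  assumes "u \<in> V" "v \<in> V" "u \<noteq> v"
  shows "swap_refl u v \<in> simplex_group V"
proof -
  have "(*v) (swap_refl u v) ` V = (\<lambda>w. if w = u then v else if w = v then u else w) ` V"
    using swap_refl_vertex assms by (intro image_cong) auto
  also have "\<dots> = V" using assms by (auto simp: image_iff)
  finally show ?thesis by (simp add: simplex_group_def orthogonal_matrix_swap_refl)
qed

text \<open>Match the tails first, then transpose the image \<open>u\<close> of \<open>x\<close>
  with \<open>y\<close>. This does not disturb the tail, as neither \<open>u\<close> nor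
  \<open>y\<close> occurs in \<open>ys\<close>.\<close>

lemma simplex_group_transitive:
  assumes "length xs = length ys" "distinct xs" "distinct ys" "set xs \<subseteq> V" "set ys \<subseteq> V"
  shows "\<exists>P\<in>simplex_group V. map ((*v) P) xs = ys"
  using assms
proof (induction xs ys rule: list_induct2)
  case Nil
  then show ?case using simplex_group_nonempty by auto
next
  case (Cons x xs y ys)
  then obtain P where P: "P \<in> simplex_group V" "map ((*v) P) xs = ys" by auto
  define u where "u = P *v x"
  have PV: "(*v) P ` V = V" and "orthogonal_matrix P"
    using P(1) by (auto simp: simplex_group_def)
  have "inj ((*v) P)"
    using \<open>orthogonal_matrix P\<close>
    by (metis inj_on_inverseI matrix_vector_mul_assoc matrix_vector_mul_lid orthogonal_matrix_def)
  moreover have "set ys = (*v) P ` set xs" by (simp flip: P(2))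
  ultimately have "u \<notin> set ys"
    using Cons.prems(1) by (simp add: u_def inj_image_mem_iff)
  moreover have "u \<in> V"
    using Cons.prems(3) by (subst PV[symmetric]) (simp add: u_def)
  ultimately have u: "u \<in> V" "u \<notin> set ys" by simp_all
  show ?case
  proof (cases "u = y")
    case True
    then show ?thesis using P by (auto simp: u_def)
  next
    case False
    have T: "swap_refl u y *v w = (if w = u then y else if w = y then u else w)" if "w \<in> V" for w
      using swap_refl_vertex that u False Cons.prems by simp
    have "map ((*v) (swap_refl u y ** P)) xs = map ((*v) (swap_refl u y)) ys"
      unfolding P(2)[symmetric] by (simp add: matrix_vector_mul_assoc)
    also have "\<dots> = ys"
      using T u Cons.prems by (intro map_idI) auto
    finally have "map ((*v) (swap_refl u y ** P)) (x # xs) = y # ys"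
      using T[OF u(1)] by (simp add: u_def matrix_vector_mul_assoc)
    then show ?thesis
      using simplex_group_mult[OF swap_refl_in_simplex_group[of u y] P(1)] u False Cons.prems
      by (intro bexI) auto
  qed
qed

end

section \<open>Invariant functions are determined by their diagonal differences\<close>

abbreviation map_pairs :: "real^'n^'n \<Rightarrow> ((real^'n) \<times> (real^'n)) list \<Rightarrow> ((real^'n) \<times> (real^'n)) list"
  where "map_pairs Q \<equiv> map (map_prod ((*v) Q) ((*v) Q))"

abbreviation diag_pairs :: "'a list \<Rightarrow> ('a \<times> 'a) list"
  where "diag_pairs zs \<equiv> map (\<lambda>z. (z, z)) zs"

lemma rdiff_map_pairs:
  assumes "\<And>B. g (Q ** B ** transpose Q) = g B"
  shows "rdiff g (map_pairs Q ps) 0 = rdiff g ps 0"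
proof -
  have "Q ** 0 ** transpose Q = 0"
    by (simp add: matrix_matrix_mult_def vec_eq_iff)
  then show ?thesis
    using rdiff_conj[of g Q ps 0] by (simp add: assms)
qed

context centered_simplex
begin

text \<open>Induction on the number of off-diagonal pairs. Overlapping pairs \<open>(x, y)\<close>, \<open>(y, y')\<close> are swapped
  into \<open>(y, y)\<close>, \<open>(x, y')\<close>. Two pairs whose second entries do not occur as first entries give \<open>0\<close>, because
  transposing these second entries is a symmetry that changes the sign. For a single off-diagonal
  pair \<open>(x, y)\<close>, all admissible \<open>y\<close> give the same value, and these values sum to \<open>0\<close>.\<close>
lemma rdiff_vertices_eq_0:
  assumes g: "rank_one_affine g"
    and inv: "\<And>P ps. P \<in> simplex_group V \<Longrightarrow> rdiff g (map_pairs P ps) 0 = rdiff g ps 0"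
    and diag: "\<And>zs. \<lbrakk>distinct zs; set zs \<subseteq> V; length zs = k\<rbrakk> \<Longrightarrow> rdiff g (diag_pairs zs) 0 = 0"
  shows "\<lbrakk>length ps = k; set ps \<subseteq> V \<times> V\<rbrakk> \<Longrightarrow> rdiff g ps 0 = 0"
proof (induction "size {#p \<in># mset ps. fst p \<noteq> snd p#}" arbitrary: ps rule: less_induct)
  case less
  show ?case
  proof (cases "distinct (map fst ps) \<and> distinct (map snd ps)")
    case False
    then show ?thesis
      using rdiff_not_distinct_fst[OF g] rdiff_not_distinct_snd[OF g] by blast
  next
    case dist: True
    have mset_remove: "mset qs = mset (p # remove1 p qs)" if "p \<in> set qs" for p and qs :: "((real^'n) \<times> (real^'n)) list"
      using that by simp
    have perm: "distinct (map fst qs)" "distinct (map snd qs)" "set qs = set ps"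
      "rdiff g ps 0 = rdiff g qs 0" "length qs = k" if "mset ps = mset qs" for qs
      using that dist less.prems(1) rdiff_mset_eq[OF that]
      by (metis mset_map mset_eq_imp_distinct_iff, metis mset_map mset_eq_imp_distinct_iff,
          metis mset_eq_setD, metis, metis mset_eq_length)
    have chain: ?thesis if xy: "(x, y) \<in> set ps" "x \<noteq> y" "y \<in> fst ` set ps" for x y
    proof -
      obtain y' where y': "(y, y') \<in> set ps" using xy by auto
      define rs where "rs = remove1 (y, y') (remove1 (x, y) ps)"
      have ms: "mset ps = mset ((x, y) # (y, y') # rs)"
        using mset_remove[OF xy(1)] mset_remove[of "(y, y')" "remove1 (x, y) ps"] xy y'
        by (simp add: rs_def in_set_remove1 del: mset_remove1)
      note q = perm[OF ms]
      have "rdiff g ((y, y) # (x, y') # rs) 0 = 0"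
      proof (rule less.hyps)
        \<comment> \<open>Both old pairs are off-diagonal, as \<open>y = y'\<close> would repeat a
          second entry; at most one of the new ones is.\<close>
        show "size {#p \<in># mset ((y, y) # (x, y') # rs). fst p \<noteq> snd p#}
          < size {#p \<in># mset ps. fst p \<noteq> snd p#}"
          unfolding ms using q(2) xy by auto
        show "length ((y, y) # (x, y') # rs) = k" using q(5) by simp
        show "set ((y, y) # (x, y') # rs) \<subseteq> V \<times> V" using q(3) less.prems(2) by auto
      qed
      then show ?thesis
        using q(4) rdiff_swap[OF g, of x y y y' rs 0] by (simp del: rdiff.simps)
    qed
    show ?thesis
    proof (cases "\<exists>p\<in>set ps. fst p \<noteq> snd p \<and> snd p \<in> fst ` set ps")
      case True
      then obtain x y where "(x, y) \<in> set ps" "x \<noteq> y" "y \<in> fst ` set ps" by force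
      then show ?thesis by (rule chain)
    next
      case nochain: False
      show ?thesis
      proof (cases "\<forall>p\<in>set ps. fst p = snd p")
        case True
        have "map (\<lambda>p. (fst p, fst p)) ps = ps"
          by (rule map_idI) (simp add: True prod_eq_iff)
        then have "ps = diag_pairs (map fst ps)"
          by (simp add: comp_def)
        moreover have "rdiff g (diag_pairs (map fst ps)) 0 = 0"
          using dist less.prems by (intro diag) auto
        ultimately show ?thesis by simp
      next
        case False
        then obtain x y where xy: "(x, y) \<in> set ps" "x \<noteq> y" by auto
        define qs where "qs = remove1 (x, y) ps"
        have ms: "mset ps = mset ((x, y) # qs)"
          using mset_remove[OF xy(1)] by (simp add: qs_def)
        note q = perm[OF ms]
        have yV: "x \<in> V" "y \<in> V" using less.prems(2) xy by auto
        have y: "y \<notin> fst ` set ps" using nochain xy by force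
        show ?thesis
        proof (cases "\<forall>p\<in>set qs. fst p = snd p")
          case False
          then obtain x' y' where xy': "(x', y') \<in> set qs" "x' \<noteq> y'" by auto
          define rs where "rs = remove1 (x', y') qs"
          have ms': "mset ps = mset ((x, y) # (x', y') # rs)"
            using ms xy' by (simp add: rs_def)
          note r = perm[OF ms']
          have xy'_ps: "(x', y') \<in> set ps"
            using q(3) xy'(1) by (metis list.set_intros(2))
          have y': "y' \<notin> fst ` set ps"
            using nochain xy'_ps xy'(2) by (metis fst_conv snd_conv)
          have y'V: "y' \<in> V" "y \<noteq> y'"
            using less.prems(2) xy'_ps r(2) by auto
          let ?T = "swap_refl y y'"
          have fix_T: "?T *v z = z" if "z \<in> V" "z \<noteq> y" "z \<noteq> y'" for z
            using swap_refl_vertex[of y y' z] yV y'V that by simp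
          \<comment> \<open>\<open>y\<close> and \<open>y'\<close> are not first entries anywhere,
            and by distinctness not second entries in \<open>rs\<close>.\<close>
          have "map_pairs ?T rs = rs"
          proof (rule map_idI)
            fix p assume "p \<in> set rs"
            then have p: "p \<in> set ps"
              using r(3) by (metis list.set_intros(2))
            have "snd p \<in> snd ` set rs" using \<open>p \<in> set rs\<close> by (rule imageI)
            then have "snd p \<noteq> y" "snd p \<noteq> y'"
              using r(2) by auto
            moreover have "fst p \<noteq> y" "fst p \<noteq> y'" using y y' p by blast+
            moreover have "fst p \<in> V" "snd p \<in> V" using p less.prems(2) by auto
            ultimately show "map_prod ((*v) ?T) ((*v) ?T) p = p"
              by (simp add: map_prod_def split_beta fix_T)
          qed
          moreover have "?T *v x = x" "?T *v x' = x'"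
            using y y' xy(1) xy'_ps less.prems(2) by (force intro!: fix_T)+
          moreover have "?T *v y = y'" "?T *v y' = y"
            using swap_refl_vertex[of y y'] yV y'V by auto
          ultimately have "map_pairs ?T ((x, y) # (x', y') # rs) = (x, y') # (x', y) # rs"
            by simp
          then have "rdiff g ((x, y') # (x', y) # rs) 0 = rdiff g ((x, y) # (x', y') # rs) 0"
            using inv[OF swap_refl_in_simplex_group[of y y'], of "(x, y) # (x', y') # rs"] yV y'V
            by (simp del: rdiff.simps)
          moreover have "rdiff g ((x', y') # (x, y) # rs) 0 = rdiff g ((x, y) # (x', y') # rs) 0"
            by (rule rdiff_mset_eq) simp
          \<comment> \<open>By symmetry the value is unchanged when \<open>y\<close> and
            \<open>y'\<close> trade places, while \<open>rdiff_swap\<close> makes it change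
            sign.\<close>
          ultimately have "rdiff g ((x, y) # (x', y') # rs) 0 = 0"
            using rdiff_swap[OF g, of x y' x' y rs 0] by linarith
          then show ?thesis using r(4) by (simp del: rdiff.simps)
        next
          case True
          define zs where "zs = map fst qs"
          have "map (\<lambda>p. (fst p, fst p)) qs = qs"
            by (rule map_idI) (simp add: True prod_eq_iff)
          then have qs: "qs = diag_pairs zs"
            by (simp add: zs_def comp_def)
          have zs: "distinct (x # zs)" "set zs \<subseteq> V" "y \<notin> set zs"
            using q(1) y less.prems(2) unfolding q(3)[symmetric] by (auto simp: zs_def)
          define F where "F w = rdiff g ((x, w) # qs) 0" for w
          have "linear F"
            unfolding F_def by (rule rdiff_linear_right[OF g])
          then have "(\<Sum>w\<in>V. F w) = 0"
            using linear_sum[of F "\<lambda>w. w" V] sum_V linear_0 by metis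
          \<comment> \<open>For \<open>w = x\<close> the list is diagonal; for \<open>w\<close> in
            \<open>zs\<close> a second entry is repeated.\<close>
          moreover have "F w = 0" if "w \<in> insert x (set zs)" for w
          proof (cases "w = x")
            case True
            have "rdiff g (diag_pairs (x # zs)) 0 = 0"
              using zs yV q(5) by (intro diag) (auto simp: qs)
            then show ?thesis by (simp add: True F_def qs del: rdiff.simps)
          next
            case False
            then have "w \<in> set zs" using that by simp
            then have "\<not> distinct (map snd ((x, w) # qs))" by (simp add: qs comp_def)
            then show ?thesis unfolding F_def by (rule rdiff_not_distinct_snd[OF g])
          qed
          moreover have "F w = F y" if w: "w \<in> V" "w \<notin> insert x (set zs)" for w
          proof (cases "w = y")
            case False
            let ?T = "swap_refl y w"
            have T: "?T *v z = (if z = y then w else if z = w then y else z)" if "z \<in> V" for z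
              using swap_refl_vertex[of y w z] yV w that False by auto
            have "map_pairs ?T ((x, y) # qs) = (x, w) # qs"
              using T zs w yV xy by (auto simp: qs)
            then show ?thesis
              using inv[OF swap_refl_in_simplex_group[of y w], of "(x, y) # qs"] yV w False
              by (simp add: F_def del: rdiff.simps list.map)
          qed simp
          \<comment> \<open>Only the admissible vertices contribute, each with the value
            \<open>F y\<close>. As \<open>y\<close> is one of them, a positive multiple of
            \<open>F y\<close> is zero.\<close>
          ultimately have "(\<Sum>w\<in>V - insert x (set zs). F y) = 0"
            using finite_V by (subst (asm) sum.mono_neutral_right[of V "V - insert x (set zs)"]) auto
          moreover have "y \<in> V - insert x (set zs)" using yV zs xy by auto
          ultimately have "F y = 0" using finite_V by auto
          then show ?thesis using q(4) by (simp add: F_def del: rdiff.simps)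
        qed
      qed
    qed
  qed
qed

text \<open>Differences are linear in each entry and the vertices span the space. In
  \<open>qs @ ps\<close>, the entries of \<open>qs\<close> are still arbitrary and those of
  \<open>ps\<close> are already vertices.\<close>

lemma rdiff_eq_0_if_vertices:
  assumes g: "rank_one_affine g"
    and V: "\<And>ps. \<lbrakk>length ps = k; set ps \<subseteq> V \<times> V\<rbrakk> \<Longrightarrow> rdiff g ps 0 = 0"
  shows "\<lbrakk>length qs + length ps = k; set ps \<subseteq> V \<times> V\<rbrakk> \<Longrightarrow> rdiff g (qs @ ps) 0 = 0"
proof (induction qs arbitrary: ps)
  case Nil
  then show ?case using V by simp
next
  case (Cons q qs)
  obtain x y where q: "q = (x, y)" by (cases q)
  have 0: "rdiff g ((u, v) # qs @ ps) 0 = 0" if "u \<in> V" "v \<in> V" for u v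
  proof -
    have "rdiff g ((u, v) # qs @ ps) 0 = rdiff g (qs @ (u, v) # ps) 0"
      by (rule rdiff_mset_eq) simp
    also have "\<dots> = 0" using that Cons.prems by (intro Cons.IH) auto
    finally show ?thesis .
  qed
  have "rdiff g ((u, y) # qs @ ps) 0 = 0" if "u \<in> V" for u
    using linear_eq_on_span[OF rdiff_linear_right[OF g] linear_zero, of V] 0[OF that] span_V
    by blast
  then show ?case
    using linear_eq_on_span[OF rdiff_linear_left[OF g] linear_zero, of V] span_V
    unfolding q append_Cons by blast
qed

lemma rdiff_eq_0_if_diag:
  assumes "rank_one_affine g"
    and "\<And>P ps. P \<in> simplex_group V \<Longrightarrow> rdiff g (map_pairs P ps) 0 = rdiff g ps 0"
    and "\<And>zs. \<lbrakk>distinct zs; set zs \<subseteq> V; length zs = k\<rbrakk> \<Longrightarrow> rdiff g (diag_pairs zs) 0 = 0"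
    and "length ps = k"
  shows "rdiff g ps 0 = 0"
  using rdiff_eq_0_if_vertices[OF assms(1) rdiff_vertices_eq_0[OF assms(1-3)], where ps = "[]" and qs = ps]
    assms(4) by simp

text \<open>Such a list contains every vertex. Letting the first left entry run over all vertices
  gives total zero, and every term but the original one repeats a left entry.\<close>

lemma rdiff_diag_too_long:
  assumes g: "rank_one_affine g" and k: "length zs > CARD('n)"
    and zs: "distinct zs" "set zs \<subseteq> V"
  shows "rdiff g (diag_pairs zs) 0 = 0"
proof -
  have V: "set zs = V"
    using zs k card_V finite_V by (metis Suc_eq_plus1 Suc_leI card_seteq distinct_card)
  obtain z ys where ys: "zs = z # ys" using k by (cases zs) auto
  define F where "F w = rdiff g ((w, z) # diag_pairs ys) 0" for w
  have "linear F"
    unfolding F_def by (rule rdiff_linear_left[OF g])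
  then have "(\<Sum>w\<in>V. F w) = 0"
    using linear_sum[of F "\<lambda>w. w" V] sum_V linear_0 by metis
  moreover have "F w = 0" if "w \<in> set ys" for w
  proof -
    have "\<not> distinct (map fst ((w, z) # diag_pairs ys))" using that by (simp add: comp_def)
    then show ?thesis unfolding F_def by (rule rdiff_not_distinct_fst[OF g])
  qed
  ultimately have "F z = 0" using V zs(1) by (auto simp: ys simp flip: V)
  then show ?thesis by (simp add: F_def ys)
qed

end

section \<open>Differences of the reference function \<open>det (mat 1 + B)\<close>\<close>

text \<open>With the indicator of \<open>K\<close> on the diagonal as base point, the determinant is
  \<open>2 ^ card K\<close>. A further axis doubles it, and doubling minus the old value reproduces
  \<open>2 ^ card K\<close>. The general \<open>K\<close> is what the induction requires;
  \<open>K = {}\<close> is the case of interest.\<close>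

lemma rdiff_det_axis:
  assumes "distinct ks" "set ks \<inter> K = {}"
  shows "rdiff (\<lambda>B :: real^'n^'n. det (mat 1 + B)) (map (\<lambda>i. (axis i 1, axis i 1)) ks)
    (\<chi> i j. if i = j \<and> i \<in> K then 1 else 0) = 2 ^ card K"
  using assms
proof (induction ks arbitrary: K)
  case Nil
  have "det (mat 1 + (\<chi> i j. if i = j \<and> i \<in> K then 1 else 0) :: real^'n^'n)
      = (\<Prod>i\<in>UNIV. if i \<in> K then 2 else 1)"
    by (subst det_diagonal) (auto simp: mat_def intro!: prod.cong)
  also have "\<dots> = 2 ^ card K"
    by (simp add: prod.If_cases)
  finally show ?case by simp
next
  case (Cons i ks)
  have e: "(\<chi> a b. if a = b \<and> a \<in> K then 1 else 0) + outer (axis i 1) (axis i 1)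
      = ((\<chi> a b. if a = b \<and> a \<in> insert i K then 1 else 0) :: real^'n^'n)"
    using Cons.prems by (auto simp: vec_eq_iff outer_def axis_def)
  have "i \<notin> K" "finite K" using Cons.prems by auto
  then show ?case
    using Cons.IH[of K] Cons.IH[of "insert i K"] Cons.prems by (simp add: e)
qed

text \<open>Rules out a degenerate comparison up to the dimension. Coordinate axes are used because
  the value is explicit there; \<open>rdiff_eq_0_if_diag\<close> carries nonvanishing over to
  vertices.\<close>

lemma rdiff_det_nonzero:
  assumes "k \<le> CARD('n)"
  obtains ps where "length ps = k" "rdiff (\<lambda>B :: real^'n^'n. det (mat 1 + B)) ps 0 \<noteq> 0"
proof -
  obtain xs :: "'n list" where xs: "set xs = UNIV" "distinct xs"
    using finite_distinct_list[OF finite] by blast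
  have 0: "(\<chi> i j. if i = j \<and> i \<in> {} then 1 else 0) = (0 :: real^'n^'n)"
    by (simp add: vec_eq_iff)
  have "length xs = CARD('n)" using xs by (metis distinct_card)
  moreover have "rdiff (\<lambda>B. det (mat 1 + B)) (map (\<lambda>i. (axis i 1, axis i 1)) (take k xs))
      (0 :: real^'n^'n) \<noteq> 0"
    using rdiff_det_axis[of "take k xs" "{}"] xs(2) unfolding 0 by simp
  ultimately show ?thesis 
    using assms by (intro that[of "map (\<lambda>i. (axis i 1, axis i 1)) (take k xs)"]) auto
qed

lemma det_orthogonal_conj:
  fixes A Q :: "real^'n^'n"
  assumes "orthogonal_matrix Q"
  shows "det (Q ** A ** transpose Q) = det A"
  using det_orthogonal_matrix[OF assms] by (auto simp: det_mul)

lemma det_mat_1_add_conj: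
  fixes Q :: "real^'n^'n"
  assumes "orthogonal_matrix Q"
  shows "det (mat 1 + Q ** B ** transpose Q) = det (mat 1 + B)"
proof -
  have "mat 1 + Q ** B ** transpose Q = Q ** (mat 1 + B) ** transpose Q"
    using assms by (simp add: orthogonal_matrix_def matrix_add_ldistrib matrix_mult_add_left)
  then show ?thesis by (simp add: det_orthogonal_conj[OF assms])
qed

section \<open>Proportionality to the reference function and orthogonal invariance\<close>

context centered_simplex
begin

text \<open>The constant, which may depend on \<open>k\<close>, is read off from one diagonal vertex
  list; transitivity of the group extends the equality to all such lists. If the reference function
  vanishes on all of them, then \<open>k\<close> exceeds the dimension and both sides are
  zero.\<close>

lemma rdiff_proportional_det:
  assumes g: "rank_one_affine g"
    and inv: "\<And>P B. P \<in> simplex_group V \<Longrightarrow> g (P ** B ** transpose P) = g B"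
  obtains c where "\<And>ps. length ps = k \<Longrightarrow> rdiff g ps 0 = c * rdiff (\<lambda>B. det (mat 1 + B)) ps 0"
proof -
  let ?E = "\<lambda>B :: real^'n^'n. det (mat 1 + B)"
  have E: "rank_one_affine ?E"
    using rank_one_affine_conj[OF det_rank_one_affine, of "mat 1" "mat 1"] by simp
  have ginv: "rdiff g (map_pairs P ps) 0 = rdiff g ps 0" if "P \<in> simplex_group V" for P ps
    using rdiff_map_pairs inv that by blast
  have Einv: "rdiff ?E (map_pairs P ps) 0 = rdiff ?E ps 0" if "P \<in> simplex_group V" for P ps
    using that by (intro rdiff_map_pairs det_mat_1_add_conj) (simp add: simplex_group_def)
  show ?thesis
  proof (cases "\<exists>zs. distinct zs \<and> set zs \<subseteq> V \<and> length zs = k \<and> rdiff ?E (diag_pairs zs) 0 \<noteq> 0")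
    case True
    then obtain zs where zs: "distinct zs" "set zs \<subseteq> V" "length zs = k"
      and nz: "rdiff ?E (diag_pairs zs) 0 \<noteq> 0" by blast
    \<comment> \<open>Chosen so that \<open>?h\<close> has zero difference along
      \<open>zs\<close>.\<close>
    define c where "c = rdiff g (diag_pairs zs) 0 / rdiff ?E (diag_pairs zs) 0"
    let ?h = "\<lambda>B. g B - c * ?E B"
    have "rdiff ?h ps 0 = 0" if "length ps = k" for ps
    proof (rule rdiff_eq_0_if_diag[OF _ _ _ that])
      show "rank_one_affine ?h"
        by (rule rank_one_affine_diff_scale[OF g E])
      show hinv: "rdiff ?h (map_pairs P ps) 0 = rdiff ?h ps 0" if "P \<in> simplex_group V" for P ps
        using ginv[OF that] Einv[OF that] by (simp add: rdiff_diff_scale)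
      fix ys assume ys: "distinct ys" "set ys \<subseteq> V" "length ys = k"
      obtain P where P: "P \<in> simplex_group V" "map ((*v) P) zs = ys"
        using simplex_group_transitive zs ys by metis
      have "diag_pairs ys = map_pairs P (diag_pairs zs)"
        using P(2) by auto
      then have "rdiff ?h (diag_pairs ys) 0 = rdiff ?h (diag_pairs zs) 0"
        by (simp only: hinv[OF P(1)])
      also have "\<dots> = 0"
        unfolding rdiff_diff_scale using nz by (simp add: c_def)
      finally show "rdiff ?h (diag_pairs ys) 0 = 0" .
    qed
    then show ?thesis using that[of c] by (simp add: rdiff_diff_scale)
  next
    case False
    then have "rdiff ?E ps 0 = 0" if "length ps = k" for ps
      using rdiff_eq_0_if_diag[OF E Einv _ that] by blast
    then have k: "k > CARD('n)"
      using rdiff_det_nonzero[where 'n='n, of k] by (metis not_le)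
    have "rdiff g ps 0 = 0" if "length ps = k" for ps
      using rdiff_eq_0_if_diag[OF g ginv _ that] rdiff_diag_too_long[OF g] k by blast
    then show ?thesis using that[of 0] by simp
  qed
qed

text \<open>At each length, the differences of \<open>g\<close> at \<open>0\<close> are a multiple
  of those of an orthogonally invariant function, so conjugation by \<open>Q\<close> leaves them
  unchanged; they determine \<open>g\<close>.\<close>

lemma orthogonal_conj_invariant:
  assumes g: "rank_one_affine g"
    and inv: "\<And>P B. P \<in> simplex_group V \<Longrightarrow> g (P ** B ** transpose P) = g B"
    and Q: "orthogonal_matrix Q"
  shows "g (Q ** B ** transpose Q) = g B"
proof -
  \<comment> \<open>The factor \<open>1\<close> matches the form of
    \<open>rdiff_diff_scale\<close>.\<close>
  have "rdiff (\<lambda>B. g (Q ** B ** transpose Q) - 1 * g B) ps 0 = 0" for ps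
  proof -
    obtain c where c: "\<And>qs. length qs = length ps \<Longrightarrow>
        rdiff g qs 0 = c * rdiff (\<lambda>B. det (mat 1 + B)) qs 0"
      using rdiff_proportional_det[OF g inv] by metis
    have "Q ** 0 ** transpose Q = 0"
      by (simp add: matrix_matrix_mult_def vec_eq_iff)
    then have "rdiff (\<lambda>B. g (Q ** B ** transpose Q)) ps 0 = rdiff g (map_pairs Q ps) 0"
      by (simp add: rdiff_conj)
    also have "\<dots> = rdiff g ps 0"
      using c rdiff_map_pairs[of "\<lambda>B. det (mat 1 + B)" Q ps] det_mat_1_add_conj[OF Q] by simp
    finally show ?thesis unfolding rdiff_diff_scale by simp
  qed
  from eq_0_if_rdiff_0[OF this, of B] show ?thesis by simp
qed

end

section \<open>Averaging over the simplex group\<close>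

text \<open>Trades a right factor of the group element for a conjugation of \<open>B\<close>, so the
  theorem becomes an invariance of the averaged function of \<open>B\<close>.\<close>

lemma f_det_mult_right: "f_det A B (P ** Q) = f_det A (Q ** B ** transpose Q) P"
  by (simp add: f_det_def matrix_transpose_mul matrix_mul_assoc)

theorem theorem4p8:
  fixes A B Q\<^sub>0 :: "real^'n^'n" and V :: "(real^'n) set"
  assumes "centered_regular_simplex V"
    and "orthogonal_matrix Q\<^sub>0"
  shows "measure_pmf.expectation (pmf_of_set (simplex_group V)) (\<lambda>P. f_det A B P) =
         measure_pmf.expectation (pmf_of_set (simplex_group V)) (\<lambda>P. f_det A B (P ** Q\<^sub>0))"
proof -
  interpret centered_simplex V by unfold_locales (rule assms(1))
  have reg: "regular_simplex_vertices V"
    using assms(1) by (simp add: centered_regular_simplex_def)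
  \<comment> \<open>The unnormalized average; both expectations divide it by the same group
    order.\<close>
  define G where "G B = (\<Sum>P\<in>simplex_group V. f_det A B P)" for B
  have "rank_one_affine G"
    unfolding G_def by (intro rank_one_affine_sum f_det_rank_one_affine)
  moreover have "G (R ** B ** transpose R) = G B" if "R \<in> simplex_group V" for R B
    unfolding G_def f_det_mult_right[symmetric]
    by (rule sum.reindex_bij_betw[OF simplex_group_right_translate[OF reg that]])
  ultimately have "G (Q\<^sub>0 ** B ** transpose Q\<^sub>0) = G B"
    using assms(2) by (rule orthogonal_conj_invariant)
  then show ?thesis
    using finite_simplex_group[OF reg] simplex_group_nonempty[of V]
    by (simp add: integral_pmf_of_set f_det_mult_right G_def)
qed

end
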